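(* Let $d\ge1$, let $G\subseteq\mathbb{T}_{\pm}^d$ be a TC-hemispace with $G\notin\{\emptyset,\mathbb{T}_{\pm}^d\}$, and let $a=(a_0,\dots,a_d)\in\mathbb{T}_{\pm}^{d+1}$ with $(a_1,\dots,a_d)\ne(\mathbb{O},\dots,\mathbb{O})$ be such that $\mathcal{H}^+(a)\subseteq G\subseteq\overline{\mathcal{H}}^+(a)$. Let $x\in G$ be a point with $\mathrm{Argmax}(a,x)\ne\emptyset$. Let $y\in\mathbb{T}_{\pm}^d$ be such that $\mathrm{Argmax}(a,x)=\mathrm{Argmax}(a,y)$ and $\mathrm{Argmax}^+(a,x)\subseteq\mathrm{Argmax}^+(a,y)$. Then $y\in G$.
   Context: Signed tropical numbers. Let $\mathbb{O}=-\infty$ be the tropical zero. $\mathbb{T}_{>\mathbb{O}}=\mathbb{R}$ (positive numbers), $\mathbb{T}_{<\mathbb{O}}=\{\ominus r: r\in\mathbb{R}\}$ (negative numbers), $\mathbb{T}_{\pm}=\mathbb{T}_{>\mathbb{O}}\cup\mathbb{T}_{<\mathbb{O}}\cup\{\mathbb{O}\}$, balanced numbers $\mathbb{T}_{\bullet}=\{\bullet r: r\in\mathbb{R}\}\cup\{\mathbb{O}\}$, symmetrized semiring $\mathbb{S}=\mathbb{T}_{\pm}\cup\mathbb{T}_{\bullet}$. The norm is $|r|=|\ominus r|=|\bullet r|=r$ and $|\mathbb{O}|=\mathbb{O}$; the sign $\mathrm{tsgn}$ takes values in $\{\oplus,\ominus,\bullet,\mathbb{O}\}$. Addition on $\mathbb{S}$: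 $x\oplus y$ equals $x$ if $|x|>|y|$, $y$ if $|y|>|x|$, $x$ if $|x|=|y|$ and $\mathrm{tsgn}(x)=\mathrm{tsgn}(y)$, and $\bullet|x|$ if $|x|=|y|$ and the signs differ. Multiplication: $x\odot y$ has norm $|x|+|y|$ and sign the product of signs (with $\oplus,\ominus,\bullet$ multiplying like $1,-1,0$); $\mathbb{O}$ is absorbing. The multiplicative unit is the real number $0$. Halfspaces. For $a\in\mathbb{T}_{\pm}^{d+1}$ with $(a_1,\dots,a_d)\ne(\mathbb{O},\dots,\mathbb{O})$, write $a(x)=a_0\oplus a_1\odot x_1\oplus\dots\oplus a_d\odot x_d$; $\mathcal{H}^+(a)=\{x\in\mathbb{T}_{\pm}^d: a(x)\in\mathbb{T}_{>\mathbb{O}}\}$, $\overline{\mathcal{H}}^+(a)=\{x\in\mathbb{T}_{\pm}^d: a(x)\in\mathbb{T}_{>\mathbb{O}}\cup\mathbb{T}_{\bullet}\}$. TC-convexity. For $x,y\in\mathbb{T}_{\pm}^d$, $\mathrm{conv}_{TC}(x,y)$ is the intersection of all closed halfspaces $\overline{\mathcal{H}}^+(b)$ containing both. A set $S$ is TC-convex if $\mathrm{conv}_{TC}(x,y)\subseteq S$ for all $x,y\in S$. A TC-hemispace is a TC-convex set whose complement in $\mathbb{T}_{\pm}^d$ is also TC-convex. Argmax sets. With the convention $x_0=0$ (the real number $0$), $\mathrm{Argmax}(a,x)=\{k\in\{0,\dots,d\}: a_k\odot x_k\ne\mathbb{O}\text{ and }|a_k|+|x_k|\ge|a_\ell|+|x_\ell|\text{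 for all }\ell\in\{0,\dots,d\}\}$ and $\mathrm{Argmax}^+(a,x)=\{k\in\mathrm{Argmax}(a,x): a_k\odot x_k\in\mathbb{T}_{>\mathbb{O}}\}$. *)

theory Defs
  imports "HOL-Library.Extended_Real" "HOL-Analysis.Finite_Cartesian_Product"
begin

section \<open>The symmetrized tropical semiring\<close>

text \<open>
  \<open>TZero\<close> is the tropical zero (minus infinity), \<open>TPos r\<close> the positive number \<open>r\<close>,
  \<open>TNeg r\<close> the negative number \<open>\<ominus> r\<close> and \<open>TBal r\<close> the balanced number \<open>\<bullet> r\<close>.
\<close>

datatype symtrop = TZero | TPos real | TNeg real | TBal real

datatype tsign = SZero | SPos | SNeg | SBal

fun tnorm :: "symtrop \<Rightarrow> ereal" where
  "tnorm TZero = -\<infinity>"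
| "tnorm (TPos r) = ereal r"
| "tnorm (TNeg r) = ereal r"
| "tnorm (TBal r) = ereal r"

fun tsgn :: "symtrop \<Rightarrow> tsign" where
  "tsgn TZero = SZero"
| "tsgn (TPos r) = SPos"
| "tsgn (TNeg r) = SNeg"
| "tsgn (TBal r) = SBal"

text \<open>
  The class constants \<open>0\<close>, \<open>1\<close>, \<open>+\<close>, \<open>*\<close> are the tropical ones: \<open>0\<close> is minus infinity, and
  \<open>1\<close> is the real number zero. In the last case of the sum the common norm is
  finite, since \<open>TZero\<close> is the only element of norm minus infinity.
\<close>

instantiation symtrop :: comm_semiring_1
begin

definition zero_symtrop :: symtrop where
  "0 = TZero"

definition one_symtrop :: symtrop where
  "1 = TPos 0"

definition plus_symtrop :: "symtrop \<Rightarrow> symtrop \<Rightarrow> symtrop" where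
  "x + y =
    (if tnorm x > tnorm y then x
     else if tnorm y > tnorm x then y
     else if tsgn x = tsgn y then x
     else TBal (real_of_ereal (tnorm x)))"

fun times_symtrop :: "symtrop \<Rightarrow> symtrop \<Rightarrow> symtrop" where
  "TZero * y = TZero"
| "x * TZero = TZero"
| "TPos r * TPos s = TPos (r + s)"
| "TNeg r * TNeg s = TPos (r + s)"
| "TPos r * TNeg s = TNeg (r + s)"
| "TNeg r * TPos s = TNeg (r + s)"
| "TBal r * TPos s = TBal (r + s)"
| "TBal r * TNeg s = TBal (r + s)"
| "TBal r * TBal s = TBal (r + s)"
| "TPos r * TBal s = TBal (r + s)"
| "TNeg r * TBal s = TBal (r + s)"

instance
proof
  fix x y z :: symtrop
  show "x + y + z = x + (y + z)"
    by (cases x; cases y; cases z) (auto simp: plus_symtrop_def)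
  show "x + y = y + x"
    by (cases x; cases y) (auto simp: plus_symtrop_def)
  show "0 + x = x"
    by (cases x) (auto simp: plus_symtrop_def zero_symtrop_def)
  show "x * y * z = x * (y * z)"
    by (cases x; cases y; cases z) auto
  show "x * y = y * x"
    by (cases x; cases y) auto
  show "1 * x = x"
    by (cases x) (auto simp: one_symtrop_def)
  show "(x + y) * z = x * z + y * z"
    by (cases x; cases y; cases z) (auto simp: plus_symtrop_def)
  show "0 * x = 0" "x * 0 = 0"
    by (cases x; simp add: zero_symtrop_def)+
  show "(0::symtrop) \<noteq> 1"
    by (simp add: zero_symtrop_def one_symtrop_def)
qed

end

lemma tnorm_mult: "tnorm (x * y) = tnorm x + tnorm y"
  by (cases x; cases y) auto

definition tpositive :: "symtrop set" where
  "tpositive = range TPos"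

definition tnegative :: "symtrop set" where
  "tnegative = range TNeg"

definition tsigned :: "symtrop set" where
  "tsigned = tpositive \<union> tnegative \<union> {0}"

definition tbalanced :: "symtrop set" where
  "tbalanced = range TBal \<union> {0}"


section \<open>Halfspaces\<close>

text \<open>
  The indices \<open>1, \<dots>, d\<close> are the elements of a finite type \<^typ>\<open>'d\<close>. The indices
  \<open>0, 1, \<dots>, d\<close> are the elements of \<^typ>\<open>'d option\<close>, with \<^term>\<open>None\<close> for the index \<open>0\<close>.
\<close>

definition signed_space :: "(symtrop ^ 'n) set" where
  "signed_space = {x. \<forall>i. x $ i \<in> tsigned}"

definition halfspace_coeffs :: "(symtrop ^ ('d::finite) option) set" where
  "halfspace_coeffs = {a \<in> signed_space. \<exists>i. a $ Some i \<noteq> 0}"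

definition affine_eval :: "symtrop ^ 'd option \<Rightarrow> symtrop ^ ('d::finite) \<Rightarrow> symtrop" where
  "affine_eval a x = a $ None + (\<Sum>i\<in>UNIV. a $ Some i * x $ i)"

definition open_halfspace :: "symtrop ^ 'd option \<Rightarrow> (symtrop ^ ('d::finite)) set" where
  "open_halfspace a = {x \<in> signed_space. affine_eval a x \<in> tpositive}"

definition closed_halfspace :: "symtrop ^ 'd option \<Rightarrow> (symtrop ^ ('d::finite)) set" where
  "closed_halfspace a = {x \<in> signed_space. affine_eval a x \<in> tpositive \<union> tbalanced}"


section \<open>TC-convexity\<close>

definition TC_conv :: "symtrop ^ 'd \<Rightarrow> symtrop ^ 'd \<Rightarrow> (symtrop ^ ('d::finite)) set" where
  "TC_conv x y =
    \<Inter> {closed_halfspace b | b. b \<in> halfspace_coeffs \<and> x \<in> closed_halfspace b \<and> y \<in> closed_halfspace b}"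

definition TC_convex :: "(symtrop ^ ('d::finite)) set \<Rightarrow> bool" where
  "TC_convex S \<longleftrightarrow> S \<subseteq> signed_space \<and> (\<forall>x\<in>S. \<forall>y\<in>S. TC_conv x y \<subseteq> S)"

definition TC_hemispace :: "(symtrop ^ ('d::finite)) set \<Rightarrow> bool" where
  "TC_hemispace G \<longleftrightarrow> TC_convex G \<and> TC_convex (signed_space - G)"


section \<open>Argmax sets\<close>

text \<open>The point extended by the coordinate \<open>x\<^sub>0\<close>, which is the semiring unit (the real number zero).\<close>

definition ext_coord :: "symtrop ^ ('d::finite) \<Rightarrow> 'd option \<Rightarrow> symtrop" where
  "ext_coord x k = (case k of None \<Rightarrow> 1 | Some i \<Rightarrow> x $ i)"

definition Argmax :: "symtrop ^ 'd option \<Rightarrow> symtrop ^ ('d::finite) \<Rightarrow> 'd option set" where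
  "Argmax a x = {k. a $ k * ext_coord x k \<noteq> 0 \<and>
    (\<forall>l. tnorm (a $ k) + tnorm (ext_coord x k) \<ge> tnorm (a $ l) + tnorm (ext_coord x l))}"

definition Argmax_pos :: "symtrop ^ 'd option \<Rightarrow> symtrop ^ ('d::finite) \<Rightarrow> 'd option set" where
  "Argmax_pos a x = {k \<in> Argmax a x. a $ k * ext_coord x k \<in> tpositive}"

end

(*
  Scaling the homogenized point (1, y) on some coordinates and scaling it strictly less on
  the others gives a point p for which y lies in the TC-hull of x and p as soon as x is, up
  to scaling, equal to y on the less scaled coordinates and of norm at most that of y
  elsewhere. Shrinking in this way the coordinates at which the maximal terms of a(y) are
  negative puts p into the open halfspace of a, so y is in G whenever x is, provided that x
  is not larger than y outside Argmax. The same argument for the complement of G and the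
  negated coefficients gives the implication when x is not smaller than y outside Argmax.
  The two are combined through a point z that is x or y on Argmax and zero outside.
*)
theory Submission
  imports Defs
begin

section \<open>Signed values of tropical sums\<close>

lemma plus_eq_signed_iff:
  assumes "u \<in> tpositive \<union> tnegative"
  shows "v + w = u \<longleftrightarrow>
    (v = u \<and> (w = u \<or> tnorm w < tnorm u)) \<or> (w = u \<and> tnorm v < tnorm u)"
  using assms
  by (cases u; cases v; cases w) (auto simp: plus_symtrop_def tpositive_def tnegative_def)

lemma tnorm_plus: "tnorm (v + w) = max (tnorm v) (tnorm w)"
  by (cases v; cases w) (auto simp: plus_symtrop_def max_def)

lemma tnorm_zero: "tnorm 0 = -\<infinity>"
  by (simp add: zero_symtrop_def)

lemma tnorm_sum_less_iff:
  assumes "finite A" "r > -\<infinity>"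
  shows "tnorm (sum f A) < r \<longleftrightarrow> (\<forall>k\<in>A. tnorm (f k) < r)"
  using assms by (induction A) (auto simp: tnorm_zero tnorm_plus)

text \<open>Addition cannot cancel: terms of equal norm and different signs give a balanced value,
  which only a strictly larger term removes. A nonzero signed total is therefore a statement about
  the single terms, and all later evaluations go through it.\<close>

lemma sum_eq_signed_iff:
  assumes "finite A" and u: "u \<in> tpositive \<union> tnegative"
  shows "sum f A = u \<longleftrightarrow> (\<exists>k\<in>A. f k = u) \<and> (\<forall>k\<in>A. f k = u \<or> tnorm (f k) < tnorm u)"
  using assms(1)
proof (induction A)
  case empty
  then show ?case
    using u by (auto simp: zero_symtrop_def tpositive_def tnegative_def)
next
  case (insert k A)
  have "tnorm u > -\<infinity>"
    using u by (auto simp: tpositive_def tnegative_def)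
  then have "tnorm (sum f A) < tnorm u \<longleftrightarrow> (\<forall>k\<in>A. tnorm (f k) < tnorm u)"
    using insert.hyps by (intro tnorm_sum_less_iff) auto
  then show ?case
    using insert.hyps insert.IH by (auto simp: plus_eq_signed_iff[OF u])
qed

lemma affine_eval_eq_sum: "affine_eval a x = (\<Sum>k\<in>UNIV. a $ k * ext_coord x k)"
proof -
  have "(\<Sum>k\<in>UNIV. a $ k * ext_coord x k) =
      a $ None * ext_coord x None + (\<Sum>k\<in>range Some. a $ k * ext_coord x k)"
    by (simp add: UNIV_option_conv)
  also have "(\<Sum>k\<in>range Some. a $ k * ext_coord x k) = (\<Sum>i\<in>UNIV. a $ Some i * x $ i)"
    by (subst sum.reindex) (auto simp: ext_coord_def)
  finally show ?thesis
    by (simp add: affine_eval_def ext_coord_def)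
qed

lemma affine_eval_eq_signed_iff:
  assumes "u \<in> tpositive \<union> tnegative"
  shows "affine_eval a x = u \<longleftrightarrow> (\<exists>k. a $ k * ext_coord x k = u) \<and>
    (\<forall>k. a $ k * ext_coord x k = u \<or> tnorm (a $ k * ext_coord x k) < tnorm u)"
  unfolding affine_eval_eq_sum sum_eq_signed_iff[OF finite assms] by auto

text \<open>Failure of membership thus means a nonzero signed value, to which the termwise criterion
  applies; membership itself also allows balanced values, for which there is no such
  criterion.\<close>

lemma in_closed_halfspace_iff:
  "x \<in> closed_halfspace a \<longleftrightarrow> x \<in> signed_space \<and> affine_eval a x \<notin> tnegative"
  by (cases "affine_eval a x")
    (auto simp: closed_halfspace_def tpositive_def tnegative_def tbalanced_def zero_symtrop_def)


section \<open>Signed coordinates and scaling\<close>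

lemma tsigned_mult: "v \<in> tsigned \<Longrightarrow> w \<in> tsigned \<Longrightarrow> v * w \<in> tsigned"
  by (cases v; cases w)
    (auto simp: tsigned_def tpositive_def tnegative_def zero_symtrop_def)

lemma tsigned_nonzero_cases:
  "v \<in> tsigned \<Longrightarrow> v \<noteq> 0 \<Longrightarrow> v \<notin> tpositive \<Longrightarrow> v \<in> tnegative"
  by (auto simp: tsigned_def)

lemma ext_coord_simps [simp]:
  "ext_coord x None = 1" "ext_coord x (Some i) = x $ i"
  by (auto simp: ext_coord_def)

lemma tsigned_ext_coord: "x \<in> signed_space \<Longrightarrow> ext_coord x k \<in> tsigned"
  by (cases k) (auto simp: signed_space_def tsigned_def tpositive_def one_symtrop_def)

lemma tsigned_term:
  "a \<in> signed_space \<Longrightarrow> x \<in> signed_space \<Longrightarrow> a $ k * ext_coord x k \<in> tsigned"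
  by (intro tsigned_mult tsigned_ext_coord) (auto simp: signed_space_def)

text \<open>A nonzero signed number is determined by its sign and norm. The common factor
  \<open>a\<close> carries equality of signs from the products to \<open>v\<close> and
  \<open>w\<close>, and \<open>TPos c\<close> shifts the norm without changing the sign.\<close>

lemma eq_scaled_if_same_sign:
  assumes "v \<in> tsigned" "w \<in> tsigned" "a * v \<noteq> 0" "a * w \<noteq> 0"
    and "a * v \<in> tpositive \<longleftrightarrow> a * w \<in> tpositive"
    and "a \<in> tsigned" "tnorm v = tnorm w + ereal c"
  shows "v = TPos c * w"
  using assms
  by (cases a; cases v; cases w)
    (auto simp: tsigned_def tpositive_def tnegative_def zero_symtrop_def)

text \<open>The coordinate of index \<open>None\<close> cannot be scaled, so the other block is scaled instead.\<close>

lemma obtain_scaled_point: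
  fixes y :: "symtrop ^ 'd::finite" and S :: "'d option set"
  assumes y: "y \<in> signed_space"
  obtains p s t where "p \<in> signed_space" "s < t"
    "\<And>k. ext_coord p k = TPos (if k \<in> S then s else t) * ext_coord y k"
proof -
  define s :: real where "s = (if None \<in> S then 0 else -1)"
  define t :: real where "t = (if None \<in> S then 1 else 0)"
  define p where "p = (\<chi> i. TPos (if Some i \<in> S then s else t) * y $ i)"
  have "TPos r \<in> tsigned" for r
    by (auto simp: tsigned_def tpositive_def)
  then have "p \<in> signed_space"
    using y by (auto simp: p_def signed_space_def intro: tsigned_mult)
  moreover have "s < t"
    by (auto simp: s_def t_def)
  moreover have "ext_coord p k = TPos (if k \<in> S then s else t) * ext_coord y k" for k
    by (cases k) (auto simp: p_def s_def t_def one_symtrop_def)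
  ultimately show thesis
    by (rule that)
qed

text \<open>No halfspace containing \<open>x\<close> and \<open>p\<close> can exclude
  \<open>y\<close>. If \<open>b\<close> is negative at \<open>y\<close>, consider the terms
  attaining that value: one outside \<open>S\<close> makes \<open>b\<close> negative at
  \<open>p\<close>, and if all lie in \<open>S\<close>, then \<open>b\<close> is negative at
  \<open>x\<close>.\<close>

lemma in_TC_conv_if_scaled:
  fixes x y p :: "symtrop ^ 'd::finite"
  assumes y: "y \<in> signed_space"
    and S: "\<And>k. k \<in> S \<Longrightarrow> ext_coord x k = TPos c * ext_coord y k"
    and nS: "\<And>k. k \<notin> S \<Longrightarrow> tnorm (ext_coord x k) \<le> tnorm (ext_coord y k) + ereal c"
    and p: "\<And>k. ext_coord p k = TPos (if k \<in> S then s else t) * ext_coord y k"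
    and st: "s < t"
  shows "y \<in> TC_conv x p"
proof -
  have "affine_eval b x \<in> tnegative \<or> affine_eval b p \<in> tnegative"
    if "affine_eval b y \<in> tnegative" for b
  proof -
    obtain r where "affine_eval b y = TNeg r"
      using \<open>affine_eval b y \<in> tnegative\<close> by (auto simp: tnegative_def)
    moreover have neg: "TNeg q \<in> tpositive \<union> tnegative" for q
      by (auto simp: tnegative_def)
    ultimately have ex: "\<exists>k. b $ k * ext_coord y k = TNeg r"
      and dom: "\<And>k. b $ k * ext_coord y k = TNeg r \<or> tnorm (b $ k * ext_coord y k) < ereal r"
      using affine_eval_eq_signed_iff[OF neg, of b y r] by auto
    have scaled: "b $ k * (TPos q * ext_coord y k) = TPos q * (b $ k * ext_coord y k)" for k q
      by (simp add: ac_simps)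
    have less: "tnorm (TPos q' * v) < ereal (q + r)"
      if "q' \<le> q" "tnorm v < ereal r" for q q' v
      using that by (cases v) auto
    show ?thesis
    proof (cases "\<exists>k. k \<notin> S \<and> b $ k * ext_coord y k = TNeg r")
      case True
      \<comment> \<open>Terms inside \<open>S\<close> have norm at most \<open>s + r\<close>, which
        is below \<open>t + r\<close>, so whatever their sign they cannot balance the dominating
        term outside \<open>S\<close>.\<close>
      have "b $ k * ext_coord p k = TNeg (t + r) \<or> tnorm (b $ k * ext_coord p k) < ereal (t + r)"
        for k
        using dom[of k] st by (auto simp: p scaled intro: less)
      moreover have "\<exists>k. b $ k * ext_coord p k = TNeg (t + r)"
        using True by (auto simp: p scaled)
      ultimately have "affine_eval b p = TNeg (t + r)"
        by (simp add: affine_eval_eq_signed_iff[OF neg])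
      then show ?thesis
        by (auto simp: tnegative_def)
    next
      case False
      have "b $ k * ext_coord x k = TNeg (c + r) \<or> tnorm (b $ k * ext_coord x k) < ereal (c + r)"
        for k
      proof (cases "k \<in> S")
        case True
        then show ?thesis
          using dom[of k] by (auto simp: S scaled intro: less)
      next
        case notin: False
        \<comment> \<open>Outside \<open>S\<close> no term attains \<open>TNeg r\<close> in this
          case, and the strict inequality survives the shift by \<open>c\<close>.\<close>
        then have "tnorm (b $ k * ext_coord y k) < ereal r"
          using False dom[of k] by auto
        then show ?thesis
          using nS[OF notin] by (cases "b $ k"; cases "ext_coord x k"; cases "ext_coord y k") auto
      qed
      moreover have "\<exists>k. b $ k * ext_coord x k = TNeg (c + r)"
      proof -
        obtain k where "b $ k * ext_coord y k = TNeg r"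
          using ex by blast
        moreover from this have "k \<in> S"
          using False by blast
        ultimately show ?thesis
          by (intro exI[of _ k]) (simp add: S scaled)
      qed
      ultimately have "affine_eval b x = TNeg (c + r)"
        by (simp add: affine_eval_eq_signed_iff[OF neg])
      then show ?thesis
        by (auto simp: tnegative_def)
    qed
  qed
  then show ?thesis
    using y unfolding TC_conv_def by (fastforce simp: in_closed_halfspace_iff)
qed


section \<open>Argmax sets\<close>

lemma Argmax_iff:
  "k \<in> Argmax a x \<longleftrightarrow> a $ k * ext_coord x k \<noteq> 0 \<and>
    (\<forall>l. tnorm (a $ l * ext_coord x l) \<le> tnorm (a $ k * ext_coord x k))"
  by (simp add: Argmax_def tnorm_mult)

lemma tnorm_eq_MInf_iff: "tnorm v = -\<infinity> \<longleftrightarrow> v = 0"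
  by (cases v) (auto simp: zero_symtrop_def)

lemma notin_Argmax_less:
  assumes "k \<in> Argmax a x" "l \<notin> Argmax a x"
  shows "tnorm (a $ l * ext_coord x l) < tnorm (a $ k * ext_coord x k)"
proof (rule ccontr)
  assume "\<not> ?thesis"
  then have eq: "tnorm (a $ l * ext_coord x l) = tnorm (a $ k * ext_coord x k)"
    using assms(1) by (force simp: Argmax_iff intro: antisym)
  then have "a $ l * ext_coord x l \<noteq> 0"
    using assms(1) by (metis Argmax_iff tnorm_eq_MInf_iff)
  then show False
    using assms eq by (simp add: Argmax_iff)
qed

text \<open>Maximal terms that are all negative share their norm, so they coincide and nothing gets
  balanced. Hence a point of the closed halfspace with a nonempty \<open>Argmax\<close> has a
  positive maximal term.\<close>

lemma affine_eval_negative_if_Argmax_pos_empty: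
  assumes "a \<in> signed_space" "x \<in> signed_space" "Argmax a x \<noteq> {}" "Argmax_pos a x = {}"
  shows "affine_eval a x \<in> tnegative"
proof -
  have neg: "a $ k * ext_coord x k \<in> tnegative" if "k \<in> Argmax a x" for k
    using that assms(4) tsigned_term[OF assms(1,2), of k]
    by (auto simp: Argmax_pos_def Argmax_iff intro: tsigned_nonzero_cases)
  obtain k where k: "k \<in> Argmax a x"
    using assms(3) by blast
  obtain r where r: "a $ k * ext_coord x k = TNeg r"
    using neg[OF k] by (auto simp: tnegative_def)
  have "a $ l * ext_coord x l = TNeg r \<or> tnorm (a $ l * ext_coord x l) < tnorm (TNeg r)" for l
  proof (cases "l \<in> Argmax a x")
    case True
    then have "tnorm (a $ l * ext_coord x l) = tnorm (TNeg r)"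
      using k by (metis Argmax_iff antisym r)
    then show ?thesis
      using neg[OF True] by (auto simp: tnegative_def)
  next
    case False
    then show ?thesis
      using notin_Argmax_less[OF k False] by (simp add: r)
  qed
  then have "affine_eval a x = TNeg r"
    using r by (subst affine_eval_eq_signed_iff) (auto simp: tnegative_def)
  then show ?thesis
    by (auto simp: tnegative_def)
qed

text \<open>The smaller factor \<open>s\<close> on the maximal terms that are not positive breaks
  their tie with the positive ones, which then dominate strictly.\<close>

lemma affine_eval_positive_if_shrunk:
  assumes S: "S = Argmax a y - Argmax_pos a y"
    and ne: "Argmax_pos a y \<noteq> {}"
    and p: "\<And>k. ext_coord p k = TPos (if k \<in> S then s else t) * ext_coord y k"
    and st: "s < t"
  shows "affine_eval a p \<in> tpositive"
proof -
  have scaled: "a $ k * ext_coord p k = TPos (if k \<in> S then s else t) * (a $ k * ext_coord y k)"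
    for k
    by (simp add: p ac_simps)
  obtain k where k: "k \<in> Argmax a y" "k \<in> Argmax_pos a y"
    using ne by (auto simp: Argmax_pos_def)
  obtain r where r: "a $ k * ext_coord y k = TPos r"
    using k by (auto simp: Argmax_pos_def tpositive_def)
  have "a $ l * ext_coord p l = TPos (t + r) \<or>
      tnorm (a $ l * ext_coord p l) < tnorm (TPos (t + r))" for l
  proof -
    consider "l \<in> S" | "l \<in> Argmax_pos a y" | "l \<notin> Argmax a y"
      by (auto simp: S)
    then show ?thesis
    proof cases
      case 1
      have "tnorm (a $ l * ext_coord y l) \<le> ereal r"
        using k(1) r by (metis Argmax_iff tnorm.simps(2))
      then show ?thesis
        using 1 st unfolding scaled by (cases "a $ l * ext_coord y l") auto
    next
      case 2
      then have "tnorm (a $ l * ext_coord y l) = ereal r"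
        using k(1) r
        by (metis (no_types, lifting) Argmax_iff Argmax_pos_def antisym mem_Collect_eq tnorm.simps(2))
      then have "a $ l * ext_coord y l = TPos r"
        using 2 by (auto simp: Argmax_pos_def tpositive_def)
      then show ?thesis
        using 2 unfolding scaled by (auto simp: S)
    next
      case 3
      then show ?thesis
        using notin_Argmax_less[OF k(1) 3] unfolding scaled
        by (cases "a $ l * ext_coord y l") (auto simp: S r)
    qed
  qed
  moreover have "a $ k * ext_coord p k = TPos (t + r)"
    using k unfolding scaled by (auto simp: S r)
  ultimately have "affine_eval a p = TPos (t + r)"
    by (subst affine_eval_eq_signed_iff) (auto simp: tpositive_def)
  then show ?thesis
    by (auto simp: tpositive_def)
qed

text \<open>The shrunk point \<open>p\<close> lies in the open halfspace, hence in \<open>G\<close>,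
  and \<open>y\<close> is in the hull of \<open>x\<close> and \<open>p\<close>. By
  \<open>mono\<close>, maximal terms that are not positive at \<open>y\<close> are not positive at
  \<open>x\<close> either; so on \<open>S\<close> the signs agree and \<open>x\<close> is a scaled
  copy of \<open>y\<close>.\<close>

lemma TC_convex_mem_if_Argmax_pos_mono:
  fixes x y :: "symtrop ^ 'd::finite"
  assumes G: "TC_convex G" "open_halfspace a \<subseteq> G" and a: "a \<in> signed_space"
    and x: "x \<in> G" and y: "y \<in> signed_space"
    and eq: "Argmax a x = Argmax a y"
    and mono: "Argmax_pos a x \<subseteq> Argmax_pos a y"
    and ne: "Argmax_pos a y \<noteq> {}"
    and on: "\<And>k. k \<in> Argmax a y \<Longrightarrow> tnorm (ext_coord x k) = tnorm (ext_coord y k) + ereal c"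
    and off: "\<And>k. k \<notin> Argmax a y \<Longrightarrow> tnorm (ext_coord x k) \<le> tnorm (ext_coord y k) + ereal c"
  shows "y \<in> G"
proof -
  define S where "S = Argmax a y - Argmax_pos a y"
  have xs: "x \<in> signed_space"
    using G(1) x by (auto simp: TC_convex_def)
  obtain p s t where p: "p \<in> signed_space" "s < t"
    "\<And>k. ext_coord p k = TPos (if k \<in> S then s else t) * ext_coord y k"
    using obtain_scaled_point[OF y, of S] by blast
  have "p \<in> G"
    using affine_eval_positive_if_shrunk[OF S_def ne p(3,2)] G(2) p(1)
    by (auto simp: open_halfspace_def)
  moreover have "y \<in> TC_conv x p"
  proof (rule in_TC_conv_if_scaled[OF y _ _ p(3,2)])
    fix k assume "k \<in> S"
    then have ky: "k \<in> Argmax a y" "k \<notin> Argmax_pos a y"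
      by (auto simp: S_def)
    then have kx: "k \<in> Argmax a x" "k \<notin> Argmax_pos a x"
      using eq mono by auto
    show "ext_coord x k = TPos c * ext_coord y k"
    proof (rule eq_scaled_if_same_sign)
      show "a $ k * ext_coord x k \<in> tpositive \<longleftrightarrow> a $ k * ext_coord y k \<in> tpositive"
        using ky kx by (simp add: Argmax_pos_def)
      show "a $ k \<in> tsigned"
        using a by (simp add: signed_space_def)
    qed (use kx ky on xs y in \<open>auto simp: Argmax_iff tsigned_ext_coord\<close>)
  next
    fix k assume "k \<notin> S"
    then show "tnorm (ext_coord x k) \<le> tnorm (ext_coord y k) + ereal c"
      using on[of k] off[of k] by (cases "k \<in> Argmax a y") auto
  qed
  ultimately show ?thesis
    using G(1) x by (auto simp: TC_convex_def)
qed

section \<open>Negated coefficients and the complement of \<open>G\<close>\<close>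

definition opposite :: "symtrop ^ 'n \<Rightarrow> symtrop ^ 'n" where
  "opposite a = (\<chi> k. TNeg 0 * a $ k)"

lemma opposite_term: "opposite a $ k * v = TNeg 0 * (a $ k * v)"
  by (simp add: opposite_def ac_simps)

lemma affine_eval_opposite: "affine_eval (opposite a) x = TNeg 0 * affine_eval a x"
  by (simp add: affine_eval_eq_sum opposite_term sum_distrib_left)

lemma tneg_mult_simps:
  "TNeg 0 * v = 0 \<longleftrightarrow> v = 0"
  "tnorm (TNeg 0 * v) = tnorm v"
  "TNeg 0 * v \<in> tpositive \<longleftrightarrow> v \<in> tnegative"
  by (cases v; auto simp: zero_symtrop_def tpositive_def tnegative_def)+

lemma opposite_signed: "a \<in> signed_space \<Longrightarrow> opposite a \<in> signed_space"
  unfolding signed_space_def opposite_def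
  by (auto intro!: tsigned_mult) (auto simp: tsigned_def tnegative_def)

lemma Argmax_opposite: "Argmax (opposite a) x = Argmax a x"
  by (auto simp: set_eq_iff Argmax_iff opposite_term tneg_mult_simps)

lemma Argmax_pos_opposite:
  assumes "a \<in> signed_space" "x \<in> signed_space"
  shows "Argmax_pos (opposite a) x = Argmax a x - Argmax_pos a x"
proof -
  have "v \<in> tnegative \<longleftrightarrow> v \<notin> tpositive" if "v \<in> tsigned" "v \<noteq> 0" for v
    using that by (auto simp: tsigned_def tpositive_def tnegative_def)
  then show ?thesis
    using tsigned_term[OF assms]
    by (auto simp: Argmax_pos_def Argmax_opposite opposite_term tneg_mult_simps Argmax_iff)
qed

text \<open>If \<open>y\<close> were outside \<open>G\<close>, the previous transfer, applied to the
  complement and \<open>opposite a\<close> from \<open>y\<close> to \<open>x\<close>, would put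
  \<open>x\<close> outside \<open>G\<close>. Negation complements the positive part within
  \<open>Argmax\<close>, which reverses the inclusion and so matches the exchange of the
  points.\<close>

lemma TC_convex_compl_mem_if_Argmax_pos_mono:
  fixes x y :: "symtrop ^ 'd::finite"
  assumes G: "TC_convex (signed_space - G)" "open_halfspace a \<subseteq> G" "G \<subseteq> closed_halfspace a"
    and a: "a \<in> signed_space"
    and x: "x \<in> G" and y: "y \<in> signed_space"
    and eq: "Argmax a x = Argmax a y"
    and mono: "Argmax_pos a x \<subseteq> Argmax_pos a y"
    and ne: "Argmax a x \<noteq> {}"
    and on: "\<And>k. k \<in> Argmax a x \<Longrightarrow> tnorm (ext_coord y k) = tnorm (ext_coord x k) + ereal c"
    and off: "\<And>k. k \<notin> Argmax a x \<Longrightarrow> tnorm (ext_coord y k) \<le> tnorm (ext_coord x k) + ereal c"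
  shows "y \<in> G"
proof (rule ccontr)
  assume "y \<notin> G"
  have xs: "x \<in> signed_space"
    using G(3) x by (auto simp: closed_halfspace_def)
  \<comment> \<open>This supplies the positive maximal term of \<open>opposite a\<close> at
    \<open>x\<close> that the transfer requires.\<close>
  have "Argmax_pos a x \<noteq> Argmax a x"
  proof
    assume "Argmax_pos a x = Argmax a x"
    then have full: "Argmax a y - Argmax_pos a y = {}"
      using eq mono by auto
    obtain k where "k \<in> Argmax_pos a y"
      using ne eq full by auto
    \<comment> \<open>With \<open>S\<close> empty and \<open>t = 0\<close> the shrunk point is
      \<open>y\<close> itself; \<open>s = -1\<close> only has to be below \<open>t\<close>.\<close>
    then have "affine_eval a y \<in> tpositive"
      using full
      by (intro affine_eval_positive_if_shrunk[where S = "{}" and y = y and s = "-1" and t = 0])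
        (auto simp flip: one_symtrop_def)
    then show False
      using G(2) y \<open>y \<notin> G\<close> by (auto simp: open_halfspace_def)
  qed
  then have "Argmax a x - Argmax_pos a x \<noteq> {}"
    by (auto simp: Argmax_pos_def)
  moreover have "open_halfspace (opposite a) \<subseteq> signed_space - G"
    using G(3)
    by (auto simp: open_halfspace_def affine_eval_opposite tneg_mult_simps in_closed_halfspace_iff)
  ultimately have "x \<in> signed_space - G"
    using G(1) x y xs eq mono on off \<open>y \<notin> G\<close> opposite_signed[OF a]
    by (intro TC_convex_mem_if_Argmax_pos_mono[of "signed_space - G" "opposite a" y x c])
      (auto simp: Argmax_opposite Argmax_pos_opposite[OF a])
  then show False
    using x by simp
qed

section \<open>Truncation to the maximal coordinates and comparison of norms\<close>

definition trunc_coords :: "'d option set \<Rightarrow> symtrop ^ 'd \<Rightarrow> symtrop ^ 'd" where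
  "trunc_coords M w = (\<chi> i. if Some i \<in> M then w $ i else 0)"

lemma ext_coord_trunc_coords:
  "ext_coord (trunc_coords M w) k = (if k \<in> M \<or> k = None then ext_coord w k else 0)"
  by (cases k) (auto simp: trunc_coords_def)

lemma trunc_coords_signed: "w \<in> signed_space \<Longrightarrow> trunc_coords M w \<in> signed_space"
  by (auto simp: trunc_coords_def signed_space_def tsigned_def)

text \<open>Truncation keeps the maximal terms and can only decrease the norms of the
  others.\<close>

lemma Argmax_trunc_coords:
  assumes "Argmax a w \<noteq> {}"
  shows "Argmax a (trunc_coords (Argmax a w) w) = Argmax a w"
proof -
  let ?z = "trunc_coords (Argmax a w) w"
  have on: "ext_coord ?z k = ext_coord w k" if "k \<in> Argmax a w" for k
    using that by (simp add: ext_coord_trunc_coords)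
  have le: "tnorm (a $ l * ext_coord ?z l) \<le> tnorm (a $ l * ext_coord w l)" for l
    by (simp add: ext_coord_trunc_coords tnorm_zero)
  show ?thesis
  proof (intro equalityI subsetI)
    fix k assume k: "k \<in> Argmax a w"
    then have "tnorm (a $ l * ext_coord ?z l) \<le> tnorm (a $ k * ext_coord w k)" for l
      using le[of l] order_trans by (auto simp: Argmax_iff)
    then show "k \<in> Argmax a ?z"
      using k by (simp add: Argmax_iff[of k a "?z"] on) (simp add: Argmax_iff)
  next
    fix k assume k: "k \<in> Argmax a ?z"
    obtain m where m: "m \<in> Argmax a w"
      using assms by blast
    show "k \<in> Argmax a w"
    proof (rule ccontr)
      assume "k \<notin> Argmax a w"
      then have "tnorm (a $ k * ext_coord w k) < tnorm (a $ m * ext_coord ?z m)"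
        using notin_Argmax_less[OF m] on[OF m] by simp
      also have "\<dots> \<le> tnorm (a $ k * ext_coord ?z k)"
        using k by (simp add: Argmax_iff)
      finally show False
        using le[of k] by simp
    qed
  qed
qed

lemma Argmax_pos_trunc_coords:
  assumes "Argmax a w \<noteq> {}"
  shows "Argmax_pos a (trunc_coords (Argmax a w) w) = Argmax_pos a w"
  unfolding Argmax_pos_def Argmax_trunc_coords[OF assms]
  by (auto simp: ext_coord_trunc_coords)

text \<open>On \<open>Argmax\<close> the norms of the terms are constant, say \<alpha> at
  \<open>x\<close> and \<beta> at \<open>y\<close>. The coefficient contributes the same finite
  amount to both, so the coordinates differ by \<alpha> - \<beta> throughout.\<close>

lemma Argmax_eq_norm_shift:
  assumes eq: "Argmax a x = Argmax a y"
  obtains c where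
    "\<And>k. k \<in> Argmax a x \<Longrightarrow> tnorm (ext_coord x k) = tnorm (ext_coord y k) + ereal c"
proof (cases "Argmax a x = {}")
  case False
  then obtain m where m: "m \<in> Argmax a x"
    by blast
  obtain \<alpha> where \<alpha>: "tnorm (a $ m * ext_coord x m) = ereal \<alpha>"
    using m by (cases "a $ m * ext_coord x m") (auto simp: Argmax_iff zero_symtrop_def)
  obtain \<beta> where \<beta>: "tnorm (a $ m * ext_coord y m) = ereal \<beta>"
    using m eq by (cases "a $ m * ext_coord y m") (auto simp: Argmax_iff zero_symtrop_def)
  have "tnorm (ext_coord x k) = tnorm (ext_coord y k) + ereal (\<alpha> - \<beta>)" if k: "k \<in> Argmax a x" for k
  proof -
    have "tnorm (a $ k * ext_coord x k) = ereal \<alpha>"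
      using m k \<alpha> by (metis Argmax_iff antisym)
    moreover have "tnorm (a $ k * ext_coord y k) = ereal \<beta>"
      using m k \<beta> eq by (metis Argmax_iff antisym)
    ultimately show ?thesis
      by (cases "a $ k"; cases "ext_coord x k"; cases "ext_coord y k") auto
  qed
  then show thesis
    by (rule that)
qed (use that in blast)

theorem proposition4p16:
  fixes G :: "(symtrop ^ 'd::finite) set"
    and a :: "symtrop ^ 'd option"
    and x y :: "symtrop ^ 'd"
  assumes "TC_hemispace G"
    and "G \<noteq> {}"
    and "G \<noteq> signed_space"
    and "a \<in> halfspace_coeffs"
    and "open_halfspace a \<subseteq> G"
    and "G \<subseteq> closed_halfspace a"
    and "x \<in> G"
    and "Argmax a x \<noteq> {}"
    and "y \<in> signed_space"
    and "Argmax a x = Argmax a y"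
    and "Argmax_pos a x \<subseteq> Argmax_pos a y"
  shows "y \<in> G"
proof -
  have G: "TC_convex G" "TC_convex (signed_space - G)"
    using assms(1) by (auto simp: TC_hemispace_def)
  have a: "a \<in> signed_space"
    using assms(4) by (simp add: halfspace_coeffs_def)
  have xs: "x \<in> signed_space" and "affine_eval a x \<notin> tnegative"
    using assms(6,7) by (auto simp: in_closed_halfspace_iff)
  then have "Argmax_pos a x \<noteq> {}"
    using affine_eval_negative_if_Argmax_pos_empty[OF a xs assms(8)] by blast
  then have pos: "Argmax_pos a y \<noteq> {}"
    using assms(11) by auto
  obtain c where c: "\<And>k. k \<in> Argmax a x \<Longrightarrow>
      tnorm (ext_coord x k) = tnorm (ext_coord y k) + ereal c"
    using Argmax_eq_norm_shift[OF assms(10)] by blast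
  have c': "tnorm (ext_coord y k) = tnorm (ext_coord x k) + ereal (-c)" if "k \<in> Argmax a x" for k
    using c[OF that] by (cases "tnorm (ext_coord y k)") auto
  note up = TC_convex_mem_if_Argmax_pos_mono[OF G(1) assms(5) a]
  note down = TC_convex_compl_mem_if_Argmax_pos_mono[OF G(2) assms(5,6) a assms(7) _ _ _ assms(8)]
  have ney: "Argmax a y \<noteq> {}"
    using assms(8,10) by simp
  \<comment> \<open>The coordinate of index \<open>None\<close> has norm zero for all points, so the sign of \<open>c\<close> decides
    which of \<open>x\<close> and \<open>y\<close> has to be truncated.\<close>
  show ?thesis
  proof (cases "c \<le> 0")
    case True
    let ?z = "trunc_coords (Argmax a y) y"
    \<comment> \<open>Outside \<open>Argmax\<close> only the index \<open>None\<close> can be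
      nonzero in \<open>?z\<close>; there the bound for the step from \<open>x\<close> reads
      \<open>0 \<le> -c\<close>. The step from \<open>?z\<close> to \<open>y\<close> needs no
      shift.\<close>
    have "?z \<in> G"
      by (rule down[where c = "-c"])
        (use True assms(9-11) c' in \<open>auto simp: trunc_coords_signed Argmax_trunc_coords[OF ney]
          Argmax_pos_trunc_coords[OF ney] ext_coord_trunc_coords tnorm_zero one_symtrop_def\<close>)
    then show ?thesis
      by (rule up[where c = 0])
        (use pos assms(9) in \<open>auto simp: Argmax_trunc_coords[OF ney]
          Argmax_pos_trunc_coords[OF ney] ext_coord_trunc_coords tnorm_zero simp flip: zero_ereal_def\<close>)
  next
    case False
    let ?z = "trunc_coords (Argmax a x) x"
    \<comment> \<open>Here \<open>?z\<close> agrees with \<open>x\<close> on \<open>Argmax\<close>,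
      so the shift by \<open>c\<close> occurs in the step from \<open>?z\<close> to
      \<open>y\<close>, where the index \<open>None\<close> requires
      \<open>0 \<le> c\<close>.\<close>
    have "?z \<in> G"
      by (rule down[where c = 0])
        (use xs in \<open>auto simp: trunc_coords_signed Argmax_trunc_coords[OF assms(8)]
          Argmax_pos_trunc_coords[OF assms(8)] ext_coord_trunc_coords tnorm_zero
          simp flip: zero_ereal_def\<close>)
    then show ?thesis
      by (rule up[where c = c])
        (use False pos assms(9,11) c in \<open>auto simp: Argmax_trunc_coords[OF assms(8)]
          Argmax_pos_trunc_coords[OF assms(8)] ext_coord_trunc_coords tnorm_zero one_symtrop_def
          simp flip: assms(10)\<close>)
  qed
qed

end
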